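(* Let $\gamma$ be the $l^r$-norm metric anisotropic surface energy $\gamma(\boldsymbol{n})=(|n_1|^r+|n_2|^r)^{1/r}$, $\boldsymbol{n}=(n_1,n_2)^T\in\mathbb{S}^1$, and let $k_0$ be its minimal stabilizing function. Then, for all $\boldsymbol{n}\in\mathbb{S}^1$: (i) when $r=4$, $k_0(\boldsymbol{n})=2\gamma(\boldsymbol{n})^{-3}$ and $\boldsymbol{Z}_{k_0}(\boldsymbol{n})=\gamma(\boldsymbol{n})^{-3}\begin{pmatrix} 1 & n_1 n_2 \\ {n_1 n_2} & 1 \end{pmatrix}$; and (ii) when $r=6$, $k_0(\boldsymbol{n})=2\gamma(\boldsymbol{n})^{-5}(n_1^4+n_1^2n_2^2+n_2^4)$.
   Context: $\mathbb{S}^1\subset\mathbb{R}^2$ is the unit circle and $^\perp$ denotes clockwise rotation by $\pi/2$, i.e. $(a,b)^\perp=(b,-a)$. A function $\gamma:\mathbb{S}^1\to(0,\infty)$ is extended by $\gamma(\boldsymbol{p})=|\boldsymbol{p}|\gamma(\boldsymbol{p}/|\boldsymbol{p}|)$ for $\boldsymbol{p}\ne\boldsymbol{0}$, $\gamma(\boldsymbol{0})=0$; $\boldsymbol{\xi}(\boldsymbol{n})=\nabla\gamma(\boldsymbol{p})|_{\boldsymbol{p}=\boldsymbol{n}}$. For $k:\mathbb{S}^1\to(0,\infty)$, the surface energy matrix is $$\boldsymbol{Z}_k(\boldsymbol{n})=\gamma(\boldsymbol{n})I_2-\boldsymbol{n}\boldsymbol{\xi}(\boldsymbol{n})^T-\boldsymbol{\xi}(\boldsymbol{n})\boldsymbol{n}^T+k(\boldsymbol{n})\boldsymbol{n}\boldsymbol{n}^T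 .$$ For $\hat{\boldsymbol{n}}\ne\pm\boldsymbol{n}$ in $\mathbb{S}^1$, $$F(\boldsymbol{n},\hat{\boldsymbol{n}})=\frac{\gamma(\hat{\boldsymbol{n}})^2-\gamma(\boldsymbol{n})^2+2\gamma(\boldsymbol{n})(\boldsymbol{\xi}(\boldsymbol{n})\cdot\hat{\boldsymbol{n}}^\perp)(\boldsymbol{n}\cdot\hat{\boldsymbol{n}}^\perp)}{\gamma(\boldsymbol{n})(\boldsymbol{n}\cdot\hat{\boldsymbol{n}}^\perp)^2},$$ extended to $\hat{\boldsymbol{n}}=\boldsymbol{n}$ by its limit as $\hat{\boldsymbol{n}}\to\boldsymbol{n}$ in $\mathbb{S}^1$. The minimal stabilizing function is $k_0(\boldsymbol{n})=\max\{F(\boldsymbol{n},\hat{\boldsymbol{n}}):\hat{\boldsymbol{n}}\in\mathbb{S}^1,\ \hat{\boldsymbol{n}}\cdot\boldsymbol{n}\ge0\}$. *)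

theory Defs
  imports "HOL-Analysis.Analysis"
begin

text \<open>
  Functions on the unit circle \<open>sphere 0 1\<close> have type \<open>real ^ 2 \<Rightarrow> real\<close>; for a unit
  vector \<open>n\<close>, the definitions below depend only on their values on the circle.
\<close>

definition perp :: "real ^ 2 \<Rightarrow> real ^ 2" where
  "perp p = vector [p $ 2, - (p $ 1)]"

definition hom_ext :: "(real ^ 2 \<Rightarrow> real) \<Rightarrow> real ^ 2 \<Rightarrow> real" where
  "hom_ext \<gamma> p = (if p = 0 then 0 else norm p * \<gamma> (p /\<^sub>R norm p))"

definition xi_vec :: "(real ^ 2 \<Rightarrow> real) \<Rightarrow> real ^ 2 \<Rightarrow> real ^ 2" where
  "xi_vec \<gamma> n = (THE D. GDERIV (hom_ext \<gamma>) n :> D)"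

definition outer :: "real ^ 2 \<Rightarrow> real ^ 2 \<Rightarrow> real ^ 2 ^ 2" where
  "outer u v = (\<chi> i j. u $ i * v $ j)"

definition surface_energy_matrix ::
    "(real ^ 2 \<Rightarrow> real) \<Rightarrow> (real ^ 2 \<Rightarrow> real) \<Rightarrow> real ^ 2 \<Rightarrow> real ^ 2 ^ 2" where
  "surface_energy_matrix \<gamma> k n =
     \<gamma> n *\<^sub>R mat 1 - outer n (xi_vec \<gamma> n) - outer (xi_vec \<gamma> n) n + k n *\<^sub>R outer n n"

definition F_quot :: "(real ^ 2 \<Rightarrow> real) \<Rightarrow> real ^ 2 \<Rightarrow> real ^ 2 \<Rightarrow> real" where
  "F_quot \<gamma> n m =
     ((\<gamma> m)\<^sup>2 - (\<gamma> n)\<^sup>2 + 2 * \<gamma> n * (xi_vec \<gamma> n \<bullet> perp m) * (n \<bullet> perp m))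
       / (\<gamma> n * (n \<bullet> perp m)\<^sup>2)"

text \<open>
  The value at \<open>m = - n\<close> is junk (division by zero); it is never used below, since the
  maximum is over \<open>m \<bullet> n \<ge> 0\<close>.
\<close>

definition F_fun :: "(real ^ 2 \<Rightarrow> real) \<Rightarrow> real ^ 2 \<Rightarrow> real ^ 2 \<Rightarrow> real" where
  "F_fun \<gamma> n m =
     (if m = n then Lim (at n within sphere 0 1) (F_quot \<gamma> n) else F_quot \<gamma> n m)"

text \<open>
  \<open>Greatest\<close> denotes an attained maximum; where no maximum exists, as where the limit
  in \<open>F_fun\<close> or the gradient in \<open>xi_vec\<close> does not exist, the value is unspecified.
\<close>

definition min_stab :: "(real ^ 2 \<Rightarrow> real) \<Rightarrow> real ^ 2 \<Rightarrow> real" where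
  "min_stab \<gamma> n =
     (GREATEST y. y \<in> {F_fun \<gamma> n m | m. m \<in> sphere 0 1 \<and> m \<bullet> n \<ge> 0})"

definition lr_energy :: "real \<Rightarrow> real ^ 2 \<Rightarrow> real" where
  "lr_energy r n = (\<bar>n $ 1\<bar> powr r + \<bar>n $ 2\<bar> powr r) powr (1 / r)"

end

theory Submission
  imports Defs
begin

text \<open>
  Write \<open>u = n\<^sub>1 n\<^sub>2\<close>, \<open>v = m\<^sub>1 m\<^sub>2\<close> and \<open>s = n \<bullet> perp m\<close>. On the circle
  \<open>n\<^sub>1\<^sup>4 + n\<^sub>2\<^sup>4 = 1 - 2 u\<^sup>2\<close> and \<open>n\<^sub>1\<^sup>6 + n\<^sub>2\<^sup>6 = 1 - 3 u\<^sup>2\<close>, and \<open>u - v = s w\<close> with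
  \<open>w = n\<^sub>2 m\<^sub>2 - n\<^sub>1 m\<^sub>1\<close>. With \<open>K\<close> the claimed maximum, \<open>(K - F) s\<^sup>2\<close> is, up to a
  positive factor, \<open>(u - v)\<^sup>2\<close> plus a gap in the inequality of arithmetic and geometric means that
  is itself a multiple of \<open>(u - v)\<^sup>2\<close>. Hence \<open>F = K - w\<^sup>2 h\<close> with \<open>h \<ge> 0\<close> continuous. This also
  provides the limit at \<open>m = n\<close>, and the maximum is attained where \<open>w = 0\<close>, namely at
  \<open>m = \<plusminus>(n\<^sub>2, n\<^sub>1)\<close>.
\<close>

section \<open>Coordinates on the unit circle\<close>

lemma inner_2: "(x :: real ^ 2) \<bullet> y = x $ 1 * y $ 1 + x $ 2 * y $ 2"
  by (simp add: inner_vec_def sum_2)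

lemma perp_nth [simp]: "perp p $ 1 = p $ 2" "perp p $ 2 = - (p $ 1)"
  by (simp_all add: perp_def)

lemma unit_circle_iff: "(p :: real ^ 2) \<in> sphere 0 1 \<longleftrightarrow> (p $ 1)\<^sup>2 + (p $ 2)\<^sup>2 = 1"
  by (simp add: norm_vec_def L2_set_def sum_2)

text \<open>Since \<open>(m \<bullet> n)^2 + (n \<bullet> perp m)^2 = 1\<close> on the circle, a
  vanishing second term leaves only \<open>m = n\<close> and \<open>m = - n\<close>; the sign
  condition discards the antipode.\<close>

lemma unit_circle_eqI:
  fixes n m :: "real ^ 2"
  assumes "n \<in> sphere 0 1" "m \<in> sphere 0 1" "n \<bullet> perp m = 0" "0 \<le> m \<bullet> n"
  shows "m = n"
proof -
  have u: "(n $ 1)\<^sup>2 + (n $ 2)\<^sup>2 = 1" "(m $ 1)\<^sup>2 + (m $ 2)\<^sup>2 = 1"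
    using assms by (simp_all only: unit_circle_iff)
  have p: "n $ 1 * m $ 2 - n $ 2 * m $ 1 = 0"
    using assms(3) by (simp add: inner_2)
  have "(m \<bullet> n)\<^sup>2 = 1"
    unfolding inner_2 using u p by algebra
  then have "m \<bullet> n = 1"
    using assms(4) by (auto simp: power2_eq_1_iff)
  then show ?thesis
    using assms(1,2) norm_cauchy_schwarz_eq[of m n] by simp
qed

section \<open>A criterion for the minimal stabilizing function\<close>

text \<open>The factorization is assumed only where the denominator of \<open>F_quot\<close> is
  nonzero. In the closed half circle this leaves out just \<open>m = n\<close>, where continuity of
  \<open>h\<close> supplies the limit.\<close>

lemma min_stab_eqI:
  fixes n :: "real ^ 2"
  assumes n: "n \<in> sphere 0 1"
    and F: "\<And>m. m \<in> sphere 0 1 \<Longrightarrow> n \<bullet> perp m \<noteq> 0 \<Longrightarrow>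
      F_quot \<gamma> n m = K - (n $ 2 * m $ 2 - n $ 1 * m $ 1)\<^sup>2 * h m"
    and h: "\<And>m. m \<in> sphere 0 1 \<Longrightarrow> 0 \<le> h m"
    and cont: "continuous (at n within sphere 0 1) h"
  shows "min_stab \<gamma> n = K"
proof -
  define H where "H m = K - (n $ 2 * m $ 2 - n $ 1 * m $ 1)\<^sup>2 * h m" for m :: "real ^ 2"
  have F_eq: "F_quot \<gamma> n m = H m" if "m \<in> sphere 0 1" "0 \<le> m \<bullet> n" "m \<noteq> n" for m
    using F[of m] unit_circle_eqI[of n m] that n by (auto simp: H_def)
  have "continuous (at n within sphere 0 1) H"
    unfolding H_def by (intro continuous_intros cont)
  then have H: "(H \<longlongrightarrow> H n) (at n within sphere 0 1)"
    by (simp add: continuous_within)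
  have "((\<lambda>m. m \<bullet> n) \<longlongrightarrow> n \<bullet> n) (at n within sphere 0 1)"
    by (intro tendsto_intros)
  moreover have "n \<bullet> n = 1"
    using n by (simp add: dot_square_norm)
  \<comment> \<open>The limit runs over the whole circle, but close to \<open>n\<close> only points
    of the open half circle matter, so the antipode does not interfere.\<close>
  ultimately have "\<forall>\<^sub>F m in at n within sphere 0 1. 0 < m \<bullet> n"
    by (auto intro: order_tendstoD(1))
  moreover have "\<forall>\<^sub>F m in at n within sphere 0 1. m \<in> sphere 0 1 \<and> m \<noteq> n"
    by (simp add: eventually_at_filter)
  ultimately have "\<forall>\<^sub>F m in at n within sphere 0 1. H m = F_quot \<gamma> n m"
    by eventually_elim (use F_eq in force)
  then have "(F_quot \<gamma> n \<longlongrightarrow> H n) (at n within sphere 0 1)"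
    using H by (rule Lim_transform_eventually[rotated])
  \<comment> \<open>\<open>Lim\<close> is pinned down only along a nontrivial filter:
    \<open>n\<close> is not isolated, the circle being connected with more than one point.\<close>
  moreover have "at n within sphere 0 1 \<noteq> bot"
  proof -
    have "n islimpt sphere 0 1"
    proof (rule connected_imp_perfect)
      show "connected (sphere (0 :: real ^ 2) 1)"
        by (simp add: connected_sphere)
      have "n \<noteq> - n" "- n \<in> sphere 0 1"
        using n unfolding unit_circle_iff by (auto simp: vec_eq_iff forall_2)
      then show "sphere 0 1 \<noteq> {a}" for a :: "real ^ 2"
        using n by (metis singletonD)
    qed (rule n)
    then show ?thesis
      by (simp add: trivial_limit_within)
  qed
  ultimately have "F_fun \<gamma> n n = H n"
    by (simp add: F_fun_def tendsto_Lim)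
  then have F_fun: "F_fun \<gamma> n m = H m" if "m \<in> sphere 0 1" "0 \<le> m \<bullet> n" for m
    using F_eq that by (cases "m = n") (auto simp: F_fun_def)
  \<comment> \<open>Reflecting \<open>n\<close> in the diagonal makes
    \<open>n $ 2 * m $ 2 - n $ 1 * m $ 1\<close> vanish. The inner product with \<open>n\<close> is
    then twice \<open>n $ 1 * n $ 2\<close> up to sign, and the sign is chosen to make it
    nonnegative.\<close>
  define m where "m = (if 0 \<le> n $ 1 * n $ 2 then 1 else -1) *\<^sub>R (vector [n $ 2, n $ 1] :: real ^ 2)"
  have m: "m \<in> sphere 0 1" "0 \<le> m \<bullet> n" "H m = K"
    using n unfolding unit_circle_iff by (auto simp: m_def H_def inner_2 algebra_simps)
  show ?thesis
    unfolding min_stab_def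
  proof (rule Greatest_equality)
    show "K \<in> {F_fun \<gamma> n m | m. m \<in> sphere 0 1 \<and> 0 \<le> m \<bullet> n}"
      using m F_fun[of m] by force
    show "y \<le> K" if "y \<in> {F_fun \<gamma> n m | m. m \<in> sphere 0 1 \<and> 0 \<le> m \<bullet> n}" for y
      using that h by (auto simp: F_fun H_def)
  qed
qed

section \<open>The energy for even exponents and its gradient\<close>

lemma lr_energy_even:
  assumes "even k" "0 < k"
  shows "lr_energy (real k) p = root k ((p $ 1) ^ k + (p $ 2) ^ k)"
proof -
  have "\<bar>x\<bar> powr real k = x ^ k" for x :: real
    using assms by (cases "x = 0") (auto simp: powr_realpow power_even_abs)
  moreover have "S powr (1 / real k) = root k S" if "0 \<le> S" for S :: real
    using that assms root_powr_inverse[of k S] by (cases "S = 0") auto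
  moreover have "0 \<le> (p $ 1) ^ k + (p $ 2) ^ k"
    using assms by (simp add: zero_le_even_power)
  ultimately show ?thesis
    by (simp add: lr_energy_def)
qed

lemma lr_energy_power:
  assumes "even k" "0 < k"
  shows "lr_energy (real k) p ^ k = (p $ 1) ^ k + (p $ 2) ^ k"
  using assms by (simp add: lr_energy_even zero_le_even_power)

lemma lr_energy_pos:
  assumes "even k" "0 < k" "p \<noteq> 0"
  shows "0 < lr_energy (real k) p"
proof -
  have "p $ 1 \<noteq> 0 \<or> p $ 2 \<noteq> 0"
    using assms(3) by (auto simp: vec_eq_iff forall_2)
  then have "0 < (p $ 1) ^ k + (p $ 2) ^ k"
    using assms(1,2) by (smt (verit) zero_le_even_power zero_less_power_eq)
  then show ?thesis
    using assms by (simp add: lr_energy_even)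
qed

lemma continuous_lr_energy:
  assumes "even k" "0 < k"
  shows "continuous (at n within S) (lr_energy (real k))"
proof -
  have "lr_energy (real k) = (\<lambda>p. root k ((p $ 1) ^ k + (p $ 2) ^ k))"
    using assms by (auto simp: lr_energy_even)
  then show ?thesis
    by (auto intro!: continuous_intros continuous_real_root)
qed

text \<open>The formula is already homogeneous of degree one on the plane, so its own gradient can
  serve for \<open>xi_vec\<close>.\<close>

lemma hom_ext_lr_energy:
  assumes "even k" "0 < k"
  shows "hom_ext (lr_energy (real k)) = lr_energy (real k)"
proof
  fix p
  show "hom_ext (lr_energy (real k)) p = lr_energy (real k) p"
  proof (cases "p = 0")
    case True
    then show ?thesis using assms by (simp add: hom_ext_def lr_energy_even)
  next
    case False
    have "root k (((p /\<^sub>R norm p) $ 1) ^ k + ((p /\<^sub>R norm p) $ 2) ^ k)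
      = root k (((p $ 1) ^ k + (p $ 2) ^ k) / norm p ^ k)"
      by (simp add: power_mult_distrib power_inverse divide_inverse algebra_simps)
    also have "\<dots> = root k ((p $ 1) ^ k + (p $ 2) ^ k) / norm p"
      using assms by (simp add: real_root_divide real_root_power_cancel)
    finally show ?thesis
      using assms False by (simp add: hom_ext_def lr_energy_even)
  qed
qed

text \<open>Chain rule through the root, which is differentiable because the sum of even powers is
  positive off the origin; the factors \<open>k\<close> cancel.\<close>

lemma xi_vec_lr_energy:
  fixes n :: "real ^ 2"
  assumes k: "even k" "0 < k" and n: "n \<noteq> 0"
  shows "xi_vec (lr_energy (real k)) n =
    vector [(n $ 1) ^ (k - 1), (n $ 2) ^ (k - 1)] /\<^sub>R lr_energy (real k) n ^ (k - 1)"
    (is "_ = ?D")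
proof -
  let ?S = "(n $ 1) ^ k + (n $ 2) ^ k"
  let ?g = "lr_energy (real k) n"
  have g: "?g = root k ?S" "0 < ?g" "0 < ?S"
    using lr_energy_even[of k n] lr_energy_pos[of k n] k n by auto
  have "DERIV (root k) ?S :> inverse (real k * ?g ^ (k - Suc 0))"
    using DERIV_real_root[of k ?S] k g by simp
  then have root: "(root k has_derivative (\<lambda>x. inverse (real k * ?g ^ (k - 1)) * x)) (at ?S)"
    by (simp add: has_field_derivative_def)
  have "((\<lambda>p :: real ^ 2. (p $ 1) ^ k + (p $ 2) ^ k) has_derivative
      (\<lambda>v. real k * v $ 1 * (n $ 1) ^ (k - 1) + real k * v $ 2 * (n $ 2) ^ (k - 1))) (at n)"
    by (auto intro!: derivative_eq_intros bounded_linear_imp_has_derivative bounded_linear_vec_nth)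
  from has_derivative_compose[OF this root]
  have "((\<lambda>p. lr_energy (real k) p) has_derivative (\<lambda>v. inverse (real k * ?g ^ (k - 1)) *
      (real k * v $ 1 * (n $ 1) ^ (k - 1) + real k * v $ 2 * (n $ 2) ^ (k - 1)))) (at n)"
    using k by (simp add: lr_energy_even)
  moreover have "inverse (real k * ?g ^ (k - 1)) *
      (real k * v $ 1 * (n $ 1) ^ (k - 1) + real k * v $ 2 * (n $ 2) ^ (k - 1)) = v \<bullet> ?D" for v
    using k g(2) by (simp add: inner_2 field_simps)
  ultimately have "((\<lambda>p. lr_energy (real k) p) has_derivative (\<lambda>v. v \<bullet> ?D)) (at n)"
    by (simp only:)
  then have "GDERIV (hom_ext (lr_energy (real k))) n :> ?D"
    using k by (simp add: gderiv_def hom_ext_lr_energy)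
  \<comment> \<open>\<open>THE\<close> also needs uniqueness: the derivative at a point is unique,
    and it determines the representing vector.\<close>
  moreover have "D = ?D" if "GDERIV (hom_ext (lr_energy (real k))) n :> D" for D
  proof -
    have "(\<lambda>v. v \<bullet> D) = (\<lambda>v. v \<bullet> ?D)"
      using has_derivative_unique that calculation unfolding gderiv_def by blast
    then show ?thesis
      unfolding fun_eq_iff vector_eq_ldot .
  qed
  ultimately show ?thesis
    unfolding xi_vec_def by blast
qed

section \<open>Polynomial identities on the circle\<close>

text \<open>Here \<open>(a, b)\<close> and \<open>(c, d)\<close> are \<open>n\<close> and
  \<open>m\<close>, while \<open>x\<close> and \<open>y\<close> are their squared energies. The left
  side is the numerator of \<open>F\<close>, with the gradient inserted, times
  \<open>x\<close>.\<close>

lemma unit_circle_quartic_identity: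
  fixes a b c d x y :: real
  assumes circle: "a\<^sup>2 + b\<^sup>2 = 1" "c\<^sup>2 + d\<^sup>2 = 1"
    and xy: "x\<^sup>2 = a ^ 4 + b ^ 4" "y\<^sup>2 = c ^ 4 + d ^ 4" "0 < x + y"
  shows "y * x - x\<^sup>2 + 2 * (a ^ 3 * d - b ^ 3 * c) * (a * d - b * c) =
    (a * d - b * c)\<^sup>2 * (2 - (b * d - a * c)\<^sup>2 * (1 + 2 * ((a * b + c * d) / (x + y))\<^sup>2))"
proof -
  define q where "q = (a * b + c * d) / (x + y)"
  define s where "s = a * d - b * c"
  define w where "w = b * d - a * c"
  have q: "q * (x + y) = a * b + c * d"
    using xy(3) by (simp add: q_def)
  have sw: "s * w = a * b - c * d"
    unfolding s_def w_def using circle by algebra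
  have x: "x\<^sup>2 = 1 - 2 * (a * b)\<^sup>2" and y: "y\<^sup>2 = 1 - 2 * (c * d)\<^sup>2"
    unfolding xy using circle by algebra+
  \<comment> \<open>Factor the difference of the two squares on both sides; cancelling
    \<open>x + y\<close> shows that \<open>x - y\<close> is a multiple of
    \<open>s * w\<close>.\<close>
  have "(x - y) * (x + y) = (- 2 * (s * w) * q) * (x + y)"
    unfolding sw using q x y by algebra
  then have diff: "x - y = - 2 * (s * w) * q"
    using xy(3) by (metis less_irrefl mult_right_cancel)
  have num: "2 * (a ^ 3 * d - b ^ 3 * c) * s - x\<^sup>2 = 2 * s\<^sup>2 - 1 + 2 * (a * b) * (c * d)"
    unfolding xy s_def using circle by algebra
  \<comment> \<open>From \<open>2 * x * y = x^2 + y^2 - (x - y)^2\<close>: the gap between the means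
    is now explicit.\<close>
  have "y * x = 1 - 2 * (a * b) * (c * d) - (s * w)\<^sup>2 - 2 * (s * w * q)\<^sup>2"
    using diff x y sw by algebra
  then show ?thesis
    unfolding q_def[symmetric] s_def[symmetric] w_def[symmetric]
    using num by algebra
qed

text \<open>The quartic scheme with cubes: the numerator is scaled by \<open>x^2\<close>, and the
  difference of cubes gives \<open>x - y\<close> as a multiple of \<open>s * w\<close>.\<close>

lemma unit_circle_sextic_identity:
  fixes a b c d x y :: real
  assumes circle: "a\<^sup>2 + b\<^sup>2 = 1" "c\<^sup>2 + d\<^sup>2 = 1"
    and xy: "x ^ 3 = a ^ 6 + b ^ 6" "y ^ 3 = c ^ 6 + d ^ 6" "0 < x\<^sup>2 + x * y + y\<^sup>2"
  shows "y * x\<^sup>2 - x ^ 3 + 2 * (a ^ 5 * d - b ^ 5 * c) * (a * d - b * c) =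
    (a * d - b * c)\<^sup>2 * (2 * (a ^ 4 + a\<^sup>2 * b\<^sup>2 + b ^ 4) - (b * d - a * c)\<^sup>2 *
      (1 + 3 * (2 * x + y) * ((a * b + c * d) / (x\<^sup>2 + x * y + y\<^sup>2))\<^sup>2))"
proof -
  define q where "q = (a * b + c * d) / (x\<^sup>2 + x * y + y\<^sup>2)"
  define s where "s = a * d - b * c"
  define w where "w = b * d - a * c"
  have q: "q * (x\<^sup>2 + x * y + y\<^sup>2) = a * b + c * d"
    using xy(3) by (simp add: q_def)
  have sw: "s * w = a * b - c * d"
    unfolding s_def w_def using circle by algebra
  have x: "x ^ 3 = 1 - 3 * (a * b)\<^sup>2" and y: "y ^ 3 = 1 - 3 * (c * d)\<^sup>2"
    unfolding xy using circle by algebra+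
  have "(x - y) * (x\<^sup>2 + x * y + y\<^sup>2) = (- 3 * (s * w) * q) * (x\<^sup>2 + x * y + y\<^sup>2)"
    unfolding sw using q x y by algebra
  then have diff: "x - y = - 3 * (s * w) * q"
    using xy(3) by (metis less_irrefl mult_right_cancel)
  have num: "2 * (a ^ 5 * d - b ^ 5 * c) * s - x ^ 3 =
      2 * (a ^ 4 + a\<^sup>2 * b\<^sup>2 + b ^ 4) * s\<^sup>2 - 1 + (a * b)\<^sup>2 + 2 * (a * b) * (c * d)"
    unfolding xy s_def using circle by algebra
  \<comment> \<open>The inequality of means for \<open>x^3\<close>, \<open>x^3\<close>,
    \<open>y^3\<close>, with its gap in factored form.\<close>
  have "3 * (y * x\<^sup>2) = 2 * x ^ 3 + y ^ 3 - (x - y)\<^sup>2 * (2 * x + y)"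
    by algebra
  then have "y * x\<^sup>2 = 1 - (a * b)\<^sup>2 - 2 * (a * b) * (c * d) - (s * w)\<^sup>2
      - 3 * (2 * x + y) * (s * w * q)\<^sup>2"
    unfolding diff x y sw by algebra
  then show ?thesis
    unfolding q_def[symmetric] s_def[symmetric] w_def[symmetric]
    using num by algebra
qed

section \<open>The minimal stabilizing functions for exponents four and six\<close>

text \<open>Expanding the fraction by \<open>x ^ (k div 2 - 1)\<close> clears the denominator of the
  gradient and produces the numerators of the circle identities.\<close>

lemma F_quot_lr_energy:
  fixes n m :: "real ^ 2"
  assumes k: "even k" "0 < k" and n: "n \<noteq> 0"
  defines "x \<equiv> (lr_energy (real k) n)\<^sup>2" and "y \<equiv> (lr_energy (real k) m)\<^sup>2"
  shows "F_quot (lr_energy (real k)) n m =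
    (y * x ^ (k div 2 - 1) - x ^ (k div 2)
      + 2 * ((n $ 1) ^ (k - 1) * m $ 2 - (n $ 2) ^ (k - 1) * m $ 1) * (n \<bullet> perp m))
    / (lr_energy (real k) n ^ (k - 1) * (n \<bullet> perp m)\<^sup>2)"
proof -
  \<comment> \<open>With this form \<open>k div 2 - 1\<close> is \<open>j\<close> and
    \<open>k - 1\<close> is \<open>2 * j + 1\<close>, so no subtraction truncates.\<close>
  obtain j where j: "k = 2 * Suc j"
    using k by (metis dvdE gr0_conv_Suc nat_0_less_mult_iff)
  let ?g = "lr_energy (real k) n"
  have "0 < ?g"
    using k n by (rule lr_energy_pos)
  then have P: "x ^ (k div 2 - 1) \<noteq> 0" "?g ^ (k - 1) = ?g * x ^ (k div 2 - 1)" "?g \<noteq> 0"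
      "x ^ (k div 2) = x * x ^ (k div 2 - 1)"
    by (simp_all add: x_def j power_mult)
  \<comment> \<open>For \<open>s = 0\<close> both sides are zero by the convention for
    division.\<close>
  have "(y - x + 2 * g * (A / (g * P)) * s) / (g * s\<^sup>2) = (y * P - x * P + 2 * A * s) / (g * P * s\<^sup>2)"
    if "g \<noteq> 0" "P \<noteq> 0" for g A P s :: real
    using that by (cases "s = 0") (simp_all add: field_simps)
  note scalar = this[OF P(3,1)]
  have "xi_vec (lr_energy (real k)) n \<bullet> perp m =
      ((n $ 1) ^ (k - 1) * m $ 2 - (n $ 2) ^ (k - 1) * m $ 1) / (?g * x ^ (k div 2 - 1))"
    unfolding xi_vec_lr_energy[OF assms(1-3)] P(2)
    by (simp add: inner_2 divide_inverse algebra_simps)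
  then show ?thesis
    unfolding F_quot_def y_def[symmetric] x_def[symmetric] P(2,4) by (simp only: scalar)
qed

text \<open>Dividing the quartic identity by
  \<open>lr_energy 4 n ^ 3 * (n \<bullet> perp m)^2\<close> yields the factorization required by the
  criterion.\<close>

lemma min_stab_lr_energy_4:
  fixes n :: "real ^ 2"
  assumes n: "n \<in> sphere 0 1"
  shows "min_stab (lr_energy 4) n = 2 / lr_energy 4 n ^ 3"
proof -
  let ?\<gamma> = "lr_energy 4"
  define q where "q m = (n $ 1 * n $ 2 + m $ 1 * m $ 2) / ((?\<gamma> n)\<^sup>2 + (?\<gamma> m)\<^sup>2)" for m
  have pos: "0 < ?\<gamma> p" if "p \<in> sphere 0 1" for p
    using lr_energy_pos[of 4 p] that by (cases "p = 0") auto
  have pow: "((?\<gamma> p)\<^sup>2)\<^sup>2 = (p $ 1) ^ 4 + (p $ 2) ^ 4" for p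
    using lr_energy_power[of 4 p] by simp
  have cont: "continuous (at n within sphere 0 1) ?\<gamma>"
    using continuous_lr_energy[of 4] by simp
  show ?thesis
  proof (rule min_stab_eqI[OF n])
    fix m :: "real ^ 2" assume m: "m \<in> sphere 0 1" and s: "n \<bullet> perp m \<noteq> 0"
    have "n \<noteq> 0"
      using n by auto
    note F_quot_lr_energy[of 4 n m, OF _ _ this]
    moreover have "0 < (?\<gamma> n)\<^sup>2 + (?\<gamma> m)\<^sup>2"
      using pos[OF n] by (simp add: add_pos_nonneg)
    note unit_circle_quartic_identity[OF n[unfolded unit_circle_iff] m[unfolded unit_circle_iff]
        pow pow this, folded q_def]
    moreover have "n \<bullet> perp m = n $ 1 * m $ 2 - n $ 2 * m $ 1"
      by (simp add: inner_2)
    ultimately show "F_quot ?\<gamma> n m = 2 / ?\<gamma> n ^ 3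
        - (n $ 2 * m $ 2 - n $ 1 * m $ 1)\<^sup>2 * ((1 + 2 * (q m)\<^sup>2) / ?\<gamma> n ^ 3)"
      using s by (simp add: diff_divide_distrib)
  next
    show "0 \<le> (1 + 2 * (q m)\<^sup>2) / ?\<gamma> n ^ 3" if "m \<in> sphere 0 1" for m
      using pos[OF n] by simp
    show "continuous (at n within sphere 0 1) (\<lambda>m. (1 + 2 * (q m)\<^sup>2) / ?\<gamma> n ^ 3)"
      unfolding q_def
      by (intro continuous_intros cont) (use pos[OF n] in simp_all)
  qed
qed

lemma min_stab_lr_energy_6:
  fixes n :: "real ^ 2"
  assumes n: "n \<in> sphere 0 1"
  shows "min_stab (lr_energy 6) n =
    2 * ((n $ 1) ^ 4 + (n $ 1)\<^sup>2 * (n $ 2)\<^sup>2 + (n $ 2) ^ 4) / lr_energy 6 n ^ 5"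
proof -
  let ?\<gamma> = "lr_energy 6"
  define x where "x = (?\<gamma> n)\<^sup>2"
  define q where
    "q m = (n $ 1 * n $ 2 + m $ 1 * m $ 2) / (x\<^sup>2 + x * (?\<gamma> m)\<^sup>2 + ((?\<gamma> m)\<^sup>2)\<^sup>2)" for m
  define h where "h m = (1 + 3 * (2 * x + (?\<gamma> m)\<^sup>2) * (q m)\<^sup>2) / ?\<gamma> n ^ 5" for m
  have pos: "0 < ?\<gamma> n" "0 < x"
    using lr_energy_pos[of 6 n] n by (cases "n = 0"; auto simp: x_def)+
  \<comment> \<open>The term \<open>x^2\<close> alone is positive, so this holds for every
    \<open>m\<close>.\<close>
  have den: "0 < x\<^sup>2 + x * (?\<gamma> m)\<^sup>2 + ((?\<gamma> m)\<^sup>2)\<^sup>2" for m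
    using pos by (simp add: add_pos_nonneg)
  have pow: "((?\<gamma> p)\<^sup>2) ^ 3 = (p $ 1) ^ 6 + (p $ 2) ^ 6" for p
    using lr_energy_power[of 6 p] by simp
  have cont: "continuous (at n within sphere 0 1) ?\<gamma>"
    using continuous_lr_energy[of 6] by simp
  show ?thesis
  proof (rule min_stab_eqI[OF n])
    fix m :: "real ^ 2" assume m: "m \<in> sphere 0 1" and s: "n \<bullet> perp m \<noteq> 0"
    have "n \<noteq> 0"
      using n by auto
    note F_quot_lr_energy[of 6 n m, OF _ _ this, folded x_def]
    moreover note unit_circle_sextic_identity[OF n[unfolded unit_circle_iff]
        m[unfolded unit_circle_iff] pow[of n, folded x_def] pow den, folded q_def]
    moreover have "n \<bullet> perp m = n $ 1 * m $ 2 - n $ 2 * m $ 1"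
      by (simp add: inner_2)
    ultimately show "F_quot ?\<gamma> n m =
        2 * ((n $ 1) ^ 4 + (n $ 1)\<^sup>2 * (n $ 2)\<^sup>2 + (n $ 2) ^ 4) / ?\<gamma> n ^ 5
        - (n $ 2 * m $ 2 - n $ 1 * m $ 1)\<^sup>2 * h m"
      using s by (simp add: h_def x_def diff_divide_distrib)
  next
    show "0 \<le> h m" if "m \<in> sphere 0 1" for m
      using pos by (simp add: h_def)
    show "continuous (at n within sphere 0 1) h"
      unfolding h_def q_def
      by (intro continuous_intros cont) (use pos den[of n] in simp_all)
  qed
qed

section \<open>The surface energy matrix for exponent four, and the conclusion\<close>

lemma surface_energy_matrix_lr_energy_4:
  fixes n :: "real ^ 2"
  assumes n: "n \<in> sphere 0 1"
  shows "surface_energy_matrix (lr_energy 4) (min_stab (lr_energy 4)) n =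
    (1 / lr_energy 4 n ^ 3) *\<^sub>R vector [vector [1, n $ 1 * n $ 2], vector [n $ 1 * n $ 2, 1]]"
proof -
  let ?g = "lr_energy 4 n"
  have "n \<noteq> 0"
    using n by auto
  have g: "0 < ?g" "?g ^ 4 = (n $ 1) ^ 4 + (n $ 2) ^ 4"
    using lr_energy_pos[of 4 n] lr_energy_power[of 4 n] \<open>n \<noteq> 0\<close> by simp_all
  have xi: "xi_vec (lr_energy 4) n = vector [(n $ 1) ^ 3, (n $ 2) ^ 3] /\<^sub>R ?g ^ 3"
    using xi_vec_lr_energy[of 4 n] \<open>n \<noteq> 0\<close> by simp
  have circle: "(n $ 1)\<^sup>2 + (n $ 2)\<^sup>2 = 1"
    using n by (simp only: unit_circle_iff)
  define c where "c = 1 / ?g ^ 3"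
  have entry: "surface_energy_matrix (lr_energy 4) (min_stab (lr_energy 4)) n $ i $ j =
      (if i = j then ?g else 0) - n $ i * (c * (n $ j) ^ 3) - c * (n $ i) ^ 3 * n $ j
      + 2 * c * (n $ i * n $ j)" for i j :: 2
    using exhaust_2[of i] exhaust_2[of j]
    by (auto simp: surface_energy_matrix_def min_stab_lr_energy_4[OF n] xi outer_def mat_def c_def
        inverse_eq_divide)
  have "?g * ?g ^ 3 = ?g ^ 4"
    by (simp add: power_eq_if)
  \<comment> \<open>This exposes \<open>c\<close> as a common factor of all entries. The diagonal
    then collapses because the difference of fourth powers equals that of squares on the
    circle.\<close>
  then have "?g = c * ((n $ 1) ^ 4 + (n $ 2) ^ 4)"
    using g by (simp add: c_def field_simps)
  then have "?g - n $ 1 * (c * (n $ 1) ^ 3) - c * (n $ 1) ^ 3 * n $ 1 + 2 * c * (n $ 1 * n $ 1) = c"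
    "?g - n $ 2 * (c * (n $ 2) ^ 3) - c * (n $ 2) ^ 3 * n $ 2 + 2 * c * (n $ 2 * n $ 2) = c"
    "0 - n $ 1 * (c * (n $ 2) ^ 3) - c * (n $ 1) ^ 3 * n $ 2 + 2 * c * (n $ 1 * n $ 2) = c * (n $ 1 * n $ 2)"
    "0 - n $ 2 * (c * (n $ 1) ^ 3) - c * (n $ 2) ^ 3 * n $ 1 + 2 * c * (n $ 2 * n $ 1) = c * (n $ 1 * n $ 2)"
    using circle by algebra+
  then show ?thesis
    unfolding c_def[symmetric] by (simp add: vec_eq_iff forall_2 entry)
qed

theorem lemma4p8:
  fixes r :: real and \<gamma> :: "real ^ 2 \<Rightarrow> real"
  assumes "\<gamma> = lr_energy r"
  shows "\<forall>n \<in> sphere 0 1.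
    (r = 4 \<longrightarrow>
       min_stab \<gamma> n = 2 * \<gamma> n powi (-3) \<and>
       surface_energy_matrix \<gamma> (min_stab \<gamma>) n =
         \<gamma> n powi (-3) *\<^sub>R vector [vector [1, n $ 1 * n $ 2], vector [n $ 1 * n $ 2, 1]]) \<and>
    (r = 6 \<longrightarrow>
       min_stab \<gamma> n =
         2 * \<gamma> n powi (-5) * ((n $ 1) ^ 4 + (n $ 1)\<^sup>2 * (n $ 2)\<^sup>2 + (n $ 2) ^ 4))"
proof -
  have "c powi (- 3) = 1 / c ^ 3" "c powi (- 5) = 1 / c ^ 5" for c :: real
    by (simp_all add: power_int_minus field_simps)
  then show ?thesis
    using assms
    by (simp add: min_stab_lr_energy_4 min_stab_lr_energy_6 surface_energy_matrix_lr_energy_4)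
qed

end
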